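(* Let $$D=\left\{-36,\tfrac12,1,2,\tfrac52,5,12,25,50,100,12^2,200,400,425,430,432,36^2,12^3\right\}.$$ Define finite sets $D_n\subseteq\mathbb{Q}$ ($n=0,1,2,\dots$) by induction: $D_0=D$, and $D_{n+1}=D_n\cup\{d_n^2\}$, where $d_n$ denotes the greatest number in $D_n$. Then for each $n\in\{0,1,2,\dots\}$, $D_n$ is an arithmetic neighbourhood of $d_n$ inside $\mathbb{Q}$, and $D_n$ is not an arithmetic neighbourhood of $d_n$ inside $\mathbb{Q}(\sqrt5)$.
   Context: Let $K$ be a ring (with $1$) and $A\subseteq K$. A map $f:A\to K$ is called arithmetic if: (1) if $1\in A$ then $f(1)=1$; (2) if $a,b\in A$ and $a+b\in A$ then $f(a+b)=f(a)+f(b)$; (3) if $a,b\in A$ and $a\cdot b\in A$ then $f(a\cdot b)=f(a)\cdot f(b)$. (In (2) and (3), $a=b$ is allowed.) A finite set $A\subseteq K$ with $r\in A$ is an arithmetic neighbourhood of $r$ inside $K$ if every arithmetic map $f:A\to K$ satisfies $f(r)=r$. *)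

theory Defs
  imports Complex_Main "HOL-Algebra.Algebraic_Closure_Type" "HOL-Algebra.Generated_Fields"
begin

text \<open>A map on \<open>A\<close> is rendered by a total function of which only the values on \<open>A\<close> matter.\<close>

definition arithmetic_map :: "('a, 'm) ring_scheme \<Rightarrow> 'a set \<Rightarrow> ('a \<Rightarrow> 'a) \<Rightarrow> bool" where
  "arithmetic_map K A f \<longleftrightarrow>
     f \<in> A \<rightarrow> carrier K \<and>
     (\<one>\<^bsub>K\<^esub> \<in> A \<longrightarrow> f \<one>\<^bsub>K\<^esub> = \<one>\<^bsub>K\<^esub>) \<and>
     (\<forall>a\<in>A. \<forall>b\<in>A. a \<oplus>\<^bsub>K\<^esub> b \<in> A \<longrightarrow> f (a \<oplus>\<^bsub>K\<^esub> b) = f a \<oplus>\<^bsub>K\<^esub> f b) \<and>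
     (\<forall>a\<in>A. \<forall>b\<in>A. a \<otimes>\<^bsub>K\<^esub> b \<in> A \<longrightarrow> f (a \<otimes>\<^bsub>K\<^esub> b) = f a \<otimes>\<^bsub>K\<^esub> f b)"

definition arithmetic_neighbourhood :: "('a, 'm) ring_scheme \<Rightarrow> 'a set \<Rightarrow> 'a \<Rightarrow> bool" where
  "arithmetic_neighbourhood K A r \<longleftrightarrow>
     finite A \<and> A \<subseteq> carrier K \<and> r \<in> A \<and> (\<forall>f. arithmetic_map K A f \<longrightarrow> f r = r)"

text \<open>
  Both fields are taken inside the reals, so that the same sets of numbers live in each of them.
\<close>

abbreviation real_field :: "real ring" where
  "real_field \<equiv> ring_of_type_algebra"

definition rat_field :: "real ring" where
  "rat_field = real_field\<lparr>carrier := \<rat>\<rparr>"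

definition rat_sqrt5_field :: "real ring" where
  "rat_sqrt5_field = real_field\<lparr>carrier := generate_field real_field (\<rat> \<union> {sqrt 5})\<rparr>"

primrec D :: "nat \<Rightarrow> real set" where
  "D 0 = {-36, 1/2, 1, 2, 5/2, 5, 12, 25, 50, 100, 12^2, 200, 400, 425, 430, 432, 36^2, 12^3}"
| "D (Suc n) = D n \<union> {(Max (D n))^2}"

definition d :: "nat \<Rightarrow> real" where
  "d n = Max (D n)"

lemma real_field_simps [simp]:
  "carrier real_field = UNIV"
  "\<one>\<^bsub>real_field\<^esub> = 1" "\<zero>\<^bsub>real_field\<^esub> = 0"
  "a \<oplus>\<^bsub>real_field\<^esub> b = a + b" "a \<otimes>\<^bsub>real_field\<^esub> b = a * b"
  by (simp_all add: ring_of_type_algebra_def)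

lemma field_real_field: "field real_field"
  by (rule field_from_type_algebra)

lemma real_field_uminus [simp]: "\<ominus>\<^bsub>real_field\<^esub> a = - a"
proof -
  interpret field real_field by (rule field_real_field)
  show ?thesis by (rule minus_equality) auto
qed

lemma real_field_inv [simp]: "a \<noteq> 0 \<Longrightarrow> inv\<^bsub>real_field\<^esub> a = inverse a"
proof -
  assume "a \<noteq> 0"
  interpret field real_field by (rule field_real_field)
  show ?thesis by (rule comm_inv_char) (use \<open>a \<noteq> 0\<close> in auto)
qed

lemma field_rat_field: "field rat_field"
proof -
  interpret field real_field by (rule field_real_field)
  have "subfield \<rat> real_field"
    by (intro subfieldI' subringI) auto
  then show ?thesis
    unfolding rat_field_def by (rule subfield_iff(2))
qed

lemma field_rat_sqrt5_field: "field rat_sqrt5_field"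
proof -
  interpret field real_field by (rule field_real_field)
  show ?thesis
    unfolding rat_sqrt5_field_def by (rule generate_field_is_field) simp
qed

lemma carrier_rat_sqrt5_field:
  "carrier rat_sqrt5_field = {a + b * sqrt 5 | a b. a \<in> \<rat> \<and> b \<in> \<rat>}" (is "_ = ?E")
proof -
  interpret field real_field by (rule field_real_field)
  have irr: "sqrt 5 \<notin> \<rat>"
  proof
    assume "sqrt 5 \<in> \<rat>"
    then obtain m n :: nat where n: "n \<noteq> 0" and eq: "\<bar>sqrt 5\<bar> = m / n" and cop: "coprime m n"
      by (rule Rats_abs_nat_div_natE)
    from eq n have "real m = sqrt 5 * n" by (simp add: field_simps)
    then have "real (m^2) = real (5 * n^2)" by (simp add: power_mult_distrib)
    then have mn: "m^2 = 5 * n^2" by (rule of_nat_eq_iff[THEN iffD1])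
    have p: "prime (5::nat)" by simp
    have "5 dvd m^2" using mn by simp
    then have "5 dvd m" using p prime_dvd_power by blast
    then obtain k where "m = 5 * k" by (elim dvdE)
    with mn have "n^2 = 5 * k^2" by (simp add: power_mult_distrib)
    then have "5 dvd n^2" by simp
    then have "5 dvd n" using p prime_dvd_power by blast
    with \<open>5 dvd m\<close> cop show False by (auto dest: coprime_common_divisor)
  qed
  have sub: "subfield ?E real_field"
  proof (intro subfieldI' subringI)
    show "?E \<subseteq> carrier real_field" by simp
    have "1 = 1 + 0 * sqrt 5 \<and> (1::real) \<in> \<rat> \<and> (0::real) \<in> \<rat>" by simp
    then show "\<one>\<^bsub>real_field\<^esub> \<in> ?E" unfolding real_field_simps by blast
  next
    fix x assume "x \<in> ?E"
    then obtain a b where "x = a + b * sqrt 5" "a \<in> \<rat>" "b \<in> \<rat>" by blast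
    then have "- x = (-a) + (-b) * sqrt 5 \<and> -a \<in> \<rat> \<and> -b \<in> \<rat>" by simp
    then show "\<ominus>\<^bsub>real_field\<^esub> x \<in> ?E" unfolding real_field_uminus by blast
  next
    fix x y assume "x \<in> ?E" "y \<in> ?E"
    then obtain a b a' b' where x: "x = a + b * sqrt 5" "a \<in> \<rat>" "b \<in> \<rat>"
      and y: "y = a' + b' * sqrt 5" "a' \<in> \<rat>" "b' \<in> \<rat>" by blast
    have "x + y = (a + a') + (b + b') * sqrt 5 \<and> a + a' \<in> \<rat> \<and> b + b' \<in> \<rat>"
      using x y by (simp add: algebra_simps)
    then show "x \<oplus>\<^bsub>real_field\<^esub> y \<in> ?E" unfolding real_field_simps by blast
    have "x * y = (a * a' + 5 * b * b') + (a * b' + b * a') * sqrt 5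
        \<and> a * a' + 5 * b * b' \<in> \<rat> \<and> a * b' + b * a' \<in> \<rat>"
      using x y by (simp add: algebra_simps)
    then show "x \<otimes>\<^bsub>real_field\<^esub> y \<in> ?E" unfolding real_field_simps by blast
  next
    fix x assume "x \<in> ?E - {\<zero>\<^bsub>real_field\<^esub>}"
    then obtain a b where x: "x = a + b * sqrt 5" "a \<in> \<rat>" "b \<in> \<rat>" and "x \<noteq> 0" by auto
    define N where "N = a^2 - 5 * b^2"
    have conj: "x * (a - b * sqrt 5) = N"
      unfolding x N_def by (simp add: algebra_simps power2_eq_square)
    have "a - b * sqrt 5 \<noteq> 0"
    proof
      assume *: "a - b * sqrt 5 = 0"
      show False
      proof (cases "b = 0")
        case True with * x \<open>x \<noteq> 0\<close> show False by simp
      next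
        case False
        with * have "sqrt 5 = a / b" by (simp add: field_simps)
        with x irr show False by simp
      qed
    qed
    with conj \<open>x \<noteq> 0\<close> have "N \<noteq> 0" by auto
    moreover have "N \<in> \<rat>" unfolding N_def using x by simp
    moreover have "inverse x = a / N + (- b / N) * sqrt 5"
      using conj \<open>x \<noteq> 0\<close> \<open>N \<noteq> 0\<close> by (simp add: field_simps)
    ultimately have "inverse x = a / N + (- b / N) * sqrt 5 \<and> a / N \<in> \<rat> \<and> - b / N \<in> \<rat>"
      using x by simp
    then show "inv\<^bsub>real_field\<^esub> x \<in> ?E" unfolding real_field_inv[OF \<open>x \<noteq> 0\<close>] by blast
  qed
  have "?E = generate_field real_field (\<rat> \<union> {sqrt 5})"
  proof (rule generate_fieldI[OF _ sub])
    show "\<rat> \<union> {sqrt 5} \<subseteq> carrier real_field" by simp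
    have "a \<in> ?E" if "a \<in> \<rat>" for a
      using that by (intro CollectI exI[of _ a] exI[of _ 0]) simp
    moreover have "sqrt 5 \<in> ?E"
      by (intro CollectI exI[of _ 0] exI[of _ 1]) simp
    ultimately show "\<rat> \<union> {sqrt 5} \<subseteq> ?E" by blast
  next
    fix K assume K: "subfield K real_field" "\<rat> \<union> {sqrt 5} \<subseteq> K"
    note sr = subringE(6,7)[OF subfieldE(1)[OF K(1)], unfolded real_field_simps]
    show "?E \<subseteq> K"
      using K(2) by (auto intro!: sr)
  qed
  then show ?thesis by (simp add: rat_sqrt5_field_def)
qed

end

theory Submission
  imports Defs "HOL-Computational_Algebra.Primes"
begin

text \<open>
  Of the elements of \<^term>\<open>D 0\<close>, an arithmetic map is forced to fix every one that is built from \<open>1\<close> by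
  the chain \<open>1/2, 2, 5/2, 5, 25, 50, 100, 200, 400, 425, 430, 432\<close>. The remaining elements
  \<open>-36, 12, 144, 1296, 1728\<close> encode a point on an elliptic curve: writing \<open>y\<close> and \<open>x\<close> for the images
  of \<open>-36\<close> and \<open>12\<close>, the number \<open>1728 = 12^3 = (-36)^2 + 432\<close> has image \<open>x^3 = y^2 + 432\<close>.

  Over the rationals this equation has only the solutions \<open>(12, 36)\<close> and \<open>(12, -36)\<close>
  (lemma \<open>mordell_432_Rats\<close>), so that \<open>1728\<close> is fixed, and hence so are its iterated squares. The
  substitution \<open>X, Y = (36 + y) / (6 x), (36 - y) / (6 x)\<close> turns the curve into \<open>X^3 + Y^3 = 1\<close>, and
  what is needed is Fermat's last theorem for exponent \<open>3\<close> (lemma \<open>fermat3_int\<close>). It is proved by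
  Euler's descent: if \<open>x^3 + y^3 + z^3 = 0\<close> with \<open>x = p + q\<close> and \<open>y = p - q\<close> odd and coprime, then
  \<open>2 p (p^2 + 3 q^2)\<close> is a cube, and its factors are cubes up to a factor of \<open>3\<close>. That
  \<open>p^2 + 3 q^2\<close> is a cube only in the obvious way, namely if \<open>p + q \<surd>-3\<close> is the cube of some
  \<open>a + b \<surd>-3\<close> (lemma \<open>square_plus_three_square_cube\<close>), comes from division with remainder in the
  Eisenstein integers. It splits \<open>2 p\<close>, up to a factor of \<open>3\<close>, into three coprime cubes that
  give a smaller solution.

  Over \<open>\<rat>(\<surd>5)\<close> the curve has the further point \<open>(8, 4 \<surd>5)\<close>, which corresponds to the identity
  \<open>(9 + \<surd>5)^3 + (9 - \<surd>5)^3 = 12^3\<close>. It gives an arithmetic map on \<^term>\<open>D 0\<close> that sends \<open>1728\<close> to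
  \<open>8^3 = 512\<close>, and the map extends to every \<^term>\<open>D n\<close>: the square of the greatest element enters no
  other relation with elements of \<^term>\<open>D n\<close> than its definition and multiplication by \<open>1\<close>
  (lemma \<open>extend_by_square\<close>).
\<close>

section \<open>Arithmetic of the Eisenstein integers\<close>

definition omega :: complex where
  "omega = Complex (-1/2) (sqrt 3 / 2)"

text \<open>
  As a subset of the complex numbers the ring inherits its algebraic laws, and the squared modulus
  serves as the norm.
\<close>

definition eisenstein :: "complex set" where
  "eisenstein = {of_int a + of_int b * omega | a b. True}"

lemma omega_square: "omega * omega = - 1 - omega"
  by (simp add: omega_def complex_eq_iff)

lemma omega_cube: "omega ^ 3 = 1"
  by (simp add: power3_eq_cube omega_square algebra_simps)

lemma eisensteinI [intro]: "of_int a + of_int b * omega \<in> eisenstein"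
  unfolding eisenstein_def by blast

lemma eisensteinE:
  assumes "z \<in> eisenstein"
  obtains a b where "z = of_int a + of_int b * omega"
  using assms unfolding eisenstein_def by blast

lemma eisenstein_omega [simp]: "omega \<in> eisenstein"
  using eisensteinI[of 0 1] by simp

lemma eisenstein_of_int [simp]: "of_int a \<in> eisenstein"
  using eisensteinI[of a 0] by simp

lemma eisenstein_0 [simp]: "0 \<in> eisenstein"
  and eisenstein_1 [simp]: "1 \<in> eisenstein"
  using eisenstein_of_int[of 0] eisenstein_of_int[of 1] by simp_all

lemma eisenstein_add [simp]:
  assumes "x \<in> eisenstein" "y \<in> eisenstein"
  shows "x + y \<in> eisenstein"
proof -
  obtain a b c e where "x = of_int a + of_int b * omega" "y = of_int c + of_int e * omega"
    using assms by (metis eisensteinE)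
  then have "x + y = of_int (a + c) + of_int (b + e) * omega"
    by (simp add: algebra_simps)
  then show ?thesis by (metis eisensteinI)
qed

lemma eisenstein_mult [simp]:
  assumes "x \<in> eisenstein" "y \<in> eisenstein"
  shows "x * y \<in> eisenstein"
proof -
  obtain a b c e where "x = of_int a + of_int b * omega" "y = of_int c + of_int e * omega"
    using assms by (metis eisensteinE)
  then have "x * y = of_int (a * c) + of_int (a * e + b * c) * omega + of_int (b * e) * (omega * omega)"
    by (simp add: algebra_simps)
  also have "\<dots> = of_int (a * c - b * e) + of_int (a * e + b * c - b * e) * omega"
    by (simp add: omega_square algebra_simps)
  finally show ?thesis by (metis eisensteinI)
qed

lemma eisenstein_uminus [simp]: "x \<in> eisenstein \<Longrightarrow> - x \<in> eisenstein"
  using eisenstein_mult[OF eisenstein_of_int[of "-1"], of x] by simp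

lemma eisenstein_diff [simp]: "x \<in> eisenstein \<Longrightarrow> y \<in> eisenstein \<Longrightarrow> x - y \<in> eisenstein"
  using eisenstein_add[of x "- y"] by simp

lemma eisenstein_power [simp]: "x \<in> eisenstein \<Longrightarrow> x ^ n \<in> eisenstein"
  by (induction n) simp_all

lemma cmod_omega_basis:
  "(cmod (of_real x + of_real y * omega))\<^sup>2 = x\<^sup>2 - x * y + y\<^sup>2"
  unfolding cmod_power2 by (simp add: omega_def power2_eq_square algebra_simps)

lemma eisenstein_cmod: "(cmod (of_int a + of_int b * omega))\<^sup>2 = of_int (a\<^sup>2 - a * b + b\<^sup>2)"
  using cmod_omega_basis[of "of_int a" "of_int b"] by simp

lemma eisenstein_eq_iff:
  "of_int a + of_int b * omega = of_int c + of_int e * omega \<longleftrightarrow> a = c \<and> b = e"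
  by (auto simp: omega_def complex_eq_iff)

text \<open>
  The quotient is rounded in each coordinate of the basis \<open>1, omega\<close>; the error \<open>u + v omega\<close>
  has norm \<open>u^2 - u v + v^2 \<le> 3/4\<close>.
\<close>

lemma eisenstein_division:
  assumes "\<beta> \<noteq> 0"
  obtains \<kappa> where "\<kappa> \<in> eisenstein" "cmod (\<alpha> - \<kappa> * \<beta>) < cmod \<beta>"
proof -
  define z where "z = \<alpha> / \<beta>"
  \<comment> \<open>\<open>x\<close> and \<open>y\<close> are the coordinates of \<open>z\<close> in the basis \<open>1, omega\<close>.\<close>
  define y where "y = Im z * 2 / sqrt 3"
  define x where "x = Re z + y / 2"
  have z: "z = of_real x + of_real y * omega"
    by (simp add: complex_eq_iff x_def y_def omega_def)
  define u v where "u = x - of_int (round x)" and "v = y - of_int (round y)"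
  define \<kappa> where "\<kappa> = of_int (round x) + of_int (round y) * omega"
  have uv: "\<bar>u\<bar> \<le> 1/2" "\<bar>v\<bar> \<le> 1/2"
    unfolding u_def v_def using of_int_round_abs_le[of x] of_int_round_abs_le[of y]
    by (simp_all add: abs_minus_commute)
  have "z - \<kappa> = of_real u + of_real v * omega"
    by (simp add: z \<kappa>_def u_def v_def algebra_simps)
  then have "(cmod (z - \<kappa>))\<^sup>2 = u\<^sup>2 - u * v + v\<^sup>2"
    by (simp only: cmod_omega_basis)
  also have "\<dots> < 1"
  proof -
    have "\<bar>u\<bar>\<^sup>2 \<le> (1/2)\<^sup>2" "\<bar>v\<bar>\<^sup>2 \<le> (1/2)\<^sup>2" using uv by (intro power_mono; simp)+
    moreover have "\<bar>u\<bar> * \<bar>v\<bar> \<le> 1/2 * (1/2)" using uv by (intro mult_mono) auto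
    then have "- (u * v) \<le> 1/4" by (simp flip: abs_mult)
    ultimately show ?thesis by (simp add: power2_eq_square)
  qed
  finally have "cmod (z - \<kappa>) < 1"
    by (metis abs_norm_cancel abs_square_less_1)
  moreover have "\<alpha> - \<kappa> * \<beta> = (z - \<kappa>) * \<beta>"
    using assms by (simp add: z_def algebra_simps)
  ultimately have "cmod (\<alpha> - \<kappa> * \<beta>) < cmod \<beta>"
    using assms by (simp add: norm_mult)
  then show thesis by (intro that[of \<kappa>]) (auto simp: \<kappa>_def)
qed

text \<open>
  A nonzero element of least norm in the ideal generated by \<open>\<alpha>\<close> and \<open>\<beta>\<close> divides every element of
  the ideal, because the remainder of a division by it lies in the ideal and has a smaller norm.
\<close>

lemma eisenstein_bezout:
  assumes \<alpha>: "\<alpha> \<in> eisenstein" "\<alpha> \<noteq> 0" and \<beta>: "\<beta> \<in> eisenstein"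
  obtains s t k l where "s \<in> eisenstein" "t \<in> eisenstein" "k \<in> eisenstein" "l \<in> eisenstein"
    "\<alpha> = k * (s * \<alpha> + t * \<beta>)" "\<beta> = l * (s * \<alpha> + t * \<beta>)"
proof -
  define I where "I = {s * \<alpha> + t * \<beta> | s t. s \<in> eisenstein \<and> t \<in> eisenstein}"
  define P where "P x \<longleftrightarrow> x \<in> I \<and> x \<noteq> 0" for x
  define N where "N x = nat \<lfloor>(cmod x)\<^sup>2\<rfloor>" for x
  have I_sub: "x \<in> eisenstein" if "x \<in> I" for x
    using that \<alpha> \<beta> by (auto simp: I_def)
  have \<alpha>I: "\<alpha> \<in> I" unfolding I_def using \<alpha>
    by (intro CollectI exI[of _ 1] exI[of _ 0]) auto
  have \<beta>I: "\<beta> \<in> I" unfolding I_def using \<beta>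
    by (intro CollectI exI[of _ 0] exI[of _ 1]) auto
  have I_closed: "x - \<kappa> * y \<in> I" if xy: "x \<in> I" "y \<in> I" and \<kappa>: "\<kappa> \<in> eisenstein" for x y \<kappa>
  proof -
    obtain s t s' t' where "x = s * \<alpha> + t * \<beta>" "y = s' * \<alpha> + t' * \<beta>"
      "s \<in> eisenstein" "t \<in> eisenstein" "s' \<in> eisenstein" "t' \<in> eisenstein"
      using xy unfolding I_def by blast
    then show ?thesis unfolding I_def using \<kappa>
      by (intro CollectI exI[of _ "s - \<kappa> * s'"] exI[of _ "t - \<kappa> * t'"]) (auto simp: algebra_simps)
  qed
  have N_less: "N x < N y" if xy: "x \<in> eisenstein" "y \<in> eisenstein" "cmod x < cmod y" for x y
  proof -
    obtain m n :: int where "(cmod x)\<^sup>2 = of_int m" "(cmod y)\<^sup>2 = of_int n"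
      using xy by (metis eisensteinE eisenstein_cmod)
    moreover have "(cmod x)\<^sup>2 < (cmod y)\<^sup>2" using xy by (intro power_strict_mono) auto
    moreover have "0 \<le> (cmod x)\<^sup>2" by simp
    ultimately show ?thesis by (simp add: N_def nat_less_eq_zless)
  qed
  have "P \<alpha>" using \<alpha> \<alpha>I by (simp add: P_def)
  then obtain \<delta> where \<delta>: "P \<delta>" and least: "\<And>y. P y \<Longrightarrow> N \<delta> \<le> N y"
    using ex_has_least_nat[of P \<alpha> N] by blast
  have mult: "\<exists>k\<in>eisenstein. x = k * \<delta>" if x: "x \<in> I" for x
  proof -
    obtain \<kappa> where \<kappa>: "\<kappa> \<in> eisenstein" "cmod (x - \<kappa> * \<delta>) < cmod \<delta>"
      using eisenstein_division[of \<delta> x] \<delta> by (auto simp: P_def)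
    have "x - \<kappa> * \<delta> \<in> I" using I_closed x \<delta> \<kappa> by (simp add: P_def)
    moreover have "\<not> P (x - \<kappa> * \<delta>)"
      using least[of "x - \<kappa> * \<delta>"] N_less[of "x - \<kappa> * \<delta>" \<delta>] \<kappa> \<delta> I_sub
      by (force simp: P_def)
    ultimately show ?thesis using \<kappa> by (auto simp: P_def)
  qed
  obtain s t where "s \<in> eisenstein" "t \<in> eisenstein" "\<delta> = s * \<alpha> + t * \<beta>"
    using \<delta> by (auto simp: P_def I_def)
  then show thesis using that mult \<alpha>I \<beta>I by metis
qed

text \<open>
  Unique factorization is avoided by taking \<open>\<delta>\<close> to be the greatest common divisor
  \<open>a \<alpha> + c \<gamma>\<close> of \<open>\<alpha>\<close> and \<open>\<gamma>\<close> and showing that \<open>\<alpha>\<close> and \<open>\<delta>^3\<close> divide each other. Expanding the cube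
  of \<open>a \<alpha> + c \<gamma>\<close> exhibits the factor \<open>\<alpha>\<close>, as \<open>\<gamma>^3 = \<alpha> \<beta>\<close>. Conversely, the square of the relation
  \<open>s \<alpha> + t \<beta> = 1\<close> writes \<open>\<alpha>\<close> as a combination of \<open>\<alpha>^3\<close> and \<open>\<alpha> \<beta> = \<gamma>^3\<close>, both multiples of \<open>\<delta>^3\<close>.
\<close>

lemma eisenstein_cube_factor:
  assumes E: "\<alpha> \<in> eisenstein" "\<beta> \<in> eisenstein" "\<gamma> \<in> eisenstein" "s \<in> eisenstein" "t \<in> eisenstein"
    and nz: "\<alpha> \<noteq> 0" and prod: "\<alpha> * \<beta> = \<gamma> ^ 3" and cop: "s * \<alpha> + t * \<beta> = 1"
  obtains u v \<delta> where "u \<in> eisenstein" "v \<in> eisenstein" "\<delta> \<in> eisenstein"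
    "u * v = 1" "\<alpha> = u * \<delta> ^ 3"
proof -
  obtain a c k l where g: "a \<in> eisenstein" "c \<in> eisenstein" "k \<in> eisenstein" "l \<in> eisenstein"
    and k: "\<alpha> = k * (a * \<alpha> + c * \<gamma>)" and l: "\<gamma> = l * (a * \<alpha> + c * \<gamma>)"
    using eisenstein_bezout[OF E(1) nz E(3)] by blast
  define \<delta> where "\<delta> = a * \<alpha> + c * \<gamma>"
  define v where "v = a ^ 3 * \<alpha>\<^sup>2 + 3 * a\<^sup>2 * c * \<alpha> * \<gamma> + 3 * a * c\<^sup>2 * \<gamma>\<^sup>2 + c ^ 3 * \<beta>"
  define u where "u = s\<^sup>2 * k ^ 3 + (2 * s * \<alpha> * t + t\<^sup>2 * \<beta>) * l ^ 3"
  have "\<delta> ^ 3 = \<alpha> * (a ^ 3 * \<alpha>\<^sup>2 + 3 * a\<^sup>2 * c * \<alpha> * \<gamma> + 3 * a * c\<^sup>2 * \<gamma>\<^sup>2) + c ^ 3 * \<gamma> ^ 3"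
    unfolding \<delta>_def by (simp add: power2_eq_square power3_eq_cube algebra_simps)
  also have "\<dots> = \<alpha> * v" unfolding v_def prod[symmetric] by (simp add: algebra_simps)
  finally have v: "\<delta> ^ 3 = \<alpha> * v" .
  have "\<alpha> = \<alpha> * (s * \<alpha> + t * \<beta>)\<^sup>2" using cop by simp
  also have "\<dots> = s\<^sup>2 * \<alpha> ^ 3 + (2 * s * \<alpha> * t + t\<^sup>2 * \<beta>) * (\<alpha> * \<beta>)"
    by (simp add: power2_eq_square power3_eq_cube algebra_simps)
  also have "\<dots> = s\<^sup>2 * (k * \<delta>) ^ 3 + (2 * s * \<alpha> * t + t\<^sup>2 * \<beta>) * (l * \<delta>) ^ 3"
    using k l prod by (simp add: \<delta>_def)
  also have "\<dots> = u * \<delta> ^ 3" unfolding u_def by (simp add: power_mult_distrib algebra_simps)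
  finally have u: "\<alpha> = u * \<delta> ^ 3" .
  have "\<alpha> * (u * v) = \<alpha>" using u v by (simp add: mult.left_commute)
  then have uv: "u * v = 1" using nz by simp
  have three: "2 \<in> eisenstein" "3 \<in> eisenstein"
    using eisenstein_of_int[of 2] eisenstein_of_int[of 3] by simp_all
  have "u \<in> eisenstein" "v \<in> eisenstein" "\<delta> \<in> eisenstein"
    unfolding u_def v_def \<delta>_def
    by (intro eisenstein_add eisenstein_mult eisenstein_power three E g)+
  then show thesis using that[of u v \<delta>] uv u by simp
qed

text \<open>
  A unit has norm \<open>1\<close>. Completing the square in \<open>4 (a^2 - a b + b^2)\<close> bounds both coordinates by \<open>1\<close>.
\<close>

lemma eisenstein_unit_cases:
  assumes "u \<in> eisenstein" "v \<in> eisenstein" "u * v = 1"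
  shows "u \<in> {1, -1, omega, - omega, omega\<^sup>2, - (omega\<^sup>2)}"
proof -
  obtain a b c e where u: "u = of_int a + of_int b * omega" and v: "v = of_int c + of_int e * omega"
    using assms by (metis eisensteinE)
  let ?M = "a\<^sup>2 - a * b + b\<^sup>2" and ?N = "c\<^sup>2 - c * e + e\<^sup>2"
  have "(cmod u)\<^sup>2 * (cmod v)\<^sup>2 = 1"
    using assms(3) by (metis norm_mult norm_one power_mult_distrib power_one)
  then have "of_int (?M * ?N) = (1::real)"
    unfolding u v eisenstein_cmod by simp
  then have MN: "?M * ?N = 1" by linarith
  have four: "4 * ?M = (2 * a - b)\<^sup>2 + 3 * b\<^sup>2" "4 * ?M = (2 * b - a)\<^sup>2 + 3 * a\<^sup>2"
    by (simp_all add: power2_eq_square algebra_simps)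
  then have "4 * ?M \<ge> 0" by (metis add_nonneg_nonneg mult_nonneg_nonneg zero_le_numeral zero_le_power2)
  then have M: "?M = 1" using MN by (auto simp: zmult_eq_1_iff)
  have "\<bar>x\<bar> < 2" if "3 * x\<^sup>2 \<le> 4" for x :: int
  proof (rule ccontr)
    assume "\<not> \<bar>x\<bar> < 2"
    then have "2\<^sup>2 \<le> \<bar>x\<bar>\<^sup>2" by (intro power_mono) auto
    then show False using that by simp
  qed
  moreover have "3 * b\<^sup>2 \<le> 4" "3 * a\<^sup>2 \<le> 4"
    using M four by (smt (verit) zero_le_power2)+
  ultimately have "\<bar>a\<bar> < 2" "\<bar>b\<bar> < 2" by blast+
  then have "a = -1 \<or> a = 0 \<or> a = 1" "b = -1 \<or> b = 0 \<or> b = 1" by auto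
  then show ?thesis
    using M by (auto simp: u power2_eq_square omega_square)
qed

section \<open>Cubes of the form \<open>p^2 + 3 q^2\<close>\<close>

lemma coprime_intI_prime:
  fixes a b :: int
  assumes "b \<noteq> 0" "\<And>p. prime p \<Longrightarrow> p dvd a \<Longrightarrow> p dvd b \<Longrightarrow> False"
  shows "coprime a b"
  using assms prime_divisor_exists[of "gcd a b"] by (auto simp: coprime_iff_gcd_eq_1)

text \<open>
  In the Eisenstein integers \<open>p^2 + 3 q^2\<close> is the product of \<open>\<alpha> = p + q \<theta>\<close> and its conjugate \<open>\<beta>\<close>,
  where \<open>\<theta>\<close> is a square root of \<open>-3\<close>. The hypotheses make them coprime, so \<open>\<alpha>\<close> is a unit times a cube
  \<open>\<delta>^3\<close>. Two points remain: \<open>\<delta>\<close> may have coordinates outside \<open>\<int>[\<theta>]\<close>, and the unit may not be a cube.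
  Since \<open>omega^3 = 1\<close>, the first is repaired by multiplying \<open>\<delta>\<close> by a power of \<open>omega\<close>. Then parity
  excludes every unit other than \<open>1\<close> and \<open>-1\<close>, for the others would make \<open>p + q\<close> even.
  The conclusion is \<open>p + q \<theta> = (a + b \<theta>)^3\<close> with the coordinates factored.
\<close>

lemma square_plus_three_square_cube:
  fixes p q r :: int
  assumes eq: "p\<^sup>2 + 3 * q\<^sup>2 = r ^ 3" and cop: "coprime p q"
    and odd: "odd (p + q)" and three: "\<not> 3 dvd p"
  obtains a b where "p = a * (a - 3 * b) * (a + 3 * b)" "q = 3 * b * (a - b) * (a + b)"
proof -
  define \<theta> where "\<theta> = 1 + 2 * omega"
  have "\<theta> * \<theta> = 1 + 4 * omega + 4 * (omega * omega)" by (simp add: \<theta>_def algebra_simps)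
  then have \<theta>2: "\<theta> * \<theta> = - 3" by (simp add: omega_square)
  have E2: "2 \<in> eisenstein" using eisenstein_of_int[of 2] by simp
  have \<theta>E: "\<theta> \<in> eisenstein" unfolding \<theta>_def by (simp add: E2)
  define \<alpha> \<beta> where "\<alpha> = of_int p + of_int q * \<theta>" and "\<beta> = of_int p - of_int q * \<theta>"
  have \<alpha>_omega: "\<alpha> = of_int (p + q) + of_int (2 * q) * omega"
    by (simp add: \<alpha>_def \<theta>_def algebra_simps)
  have E: "\<alpha> \<in> eisenstein" "\<beta> \<in> eisenstein" by (simp_all add: \<alpha>_def \<beta>_def \<theta>E)
  have "\<alpha> * \<beta> = of_int p ^ 2 - of_int q ^ 2 * (\<theta> * \<theta>)"
    by (simp add: \<alpha>_def \<beta>_def power2_eq_square algebra_simps)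
  also have "\<dots> = of_int (p\<^sup>2 + 3 * q\<^sup>2)" by (simp add: \<theta>2)
  finally have norm: "\<alpha> * \<beta> = of_int (p\<^sup>2 + 3 * q\<^sup>2)" .
  then have prod: "\<alpha> * \<beta> = of_int r ^ 3" by (simp add: eq)
  have p0: "p \<noteq> 0" using three by auto
  have nz: "\<alpha> \<noteq> 0"
  proof
    assume "\<alpha> = 0"
    then have "of_int (p\<^sup>2 + 3 * q\<^sup>2) = (0::complex)" using norm by simp
    then have "p\<^sup>2 + 3 * q\<^sup>2 = 0" by (simp only: of_int_eq_0_iff)
    then show False using p0 by (simp add: add_nonneg_eq_0_iff)
  qed
  \<comment> \<open>The ideal of \<open>\<alpha>\<close> and \<open>\<beta>\<close> contains the integers \<open>\<alpha> \<beta>\<close>, \<open>\<alpha> + \<beta> = 2 p\<close> and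
    \<open>\<theta> (\<beta> - \<alpha>) = 6 q\<close>; if these have no common divisor, it contains \<open>1\<close>.\<close>
  have "coprime (p\<^sup>2 + 3 * q\<^sup>2) (gcd (2 * p) (6 * q))"
  proof (rule coprime_intI_prime)
    show "gcd (2 * p) (6 * q) \<noteq> 0" using p0 by simp
  next
    fix l :: int
    assume l: "prime l" "l dvd p\<^sup>2 + 3 * q\<^sup>2" "l dvd gcd (2 * p) (6 * q)"
    have "l \<noteq> 2" using l(2) odd by auto
    then have "\<not> l dvd 2" using l(1) using primes_dvd_imp_eq[of l 2] by auto
    then have lp: "l dvd p" using l by (simp add: prime_dvd_mult_iff)
    then have "l \<noteq> 3" using three by auto
    then have "\<not> l dvd 3" using l(1) using primes_dvd_imp_eq[of l 3] by auto
    then have "l dvd q" using \<open>\<not> l dvd 2\<close> l prime_dvd_mult_iff[of l "2 * 3" q]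
        prime_dvd_mult_iff[of l 2 3] by simp
    then show False using lp cop l(1) by (metis coprime_common_divisor not_prime_unit)
  qed
  then obtain i j where ij: "i * (p\<^sup>2 + 3 * q\<^sup>2) + j * gcd (2 * p) (6 * q) = 1"
    by (metis bezout_int coprime_imp_gcd_eq_1)
  obtain i' j' where "i' * (2 * p) + j' * (6 * q) = gcd (2 * p) (6 * q)"
    by (metis bezout_int)
  with ij have "i * (p\<^sup>2 + 3 * q\<^sup>2) + j * (i' * (2 * p) + j' * (6 * q)) = 1" by simp
  then have "(of_int (i * (p\<^sup>2 + 3 * q\<^sup>2) + j * (i' * (2 * p) + j' * (6 * q))) :: complex) = 1"
    by simp
  then have bez: "of_int i * (\<alpha> * \<beta>) + of_int j * (of_int i' * (2 * of_int p) + of_int j' * (6 * of_int q)) = (1::complex)"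
    unfolding norm by simp
  have pe: "2 * of_int p = \<alpha> + \<beta>" by (simp add: \<alpha>_def \<beta>_def)
  have qe: "6 * of_int q = \<theta> * \<beta> - \<theta> * \<alpha>"
  proof -
    have "\<theta> * \<beta> - \<theta> * \<alpha> = - 2 * of_int q * (\<theta> * \<theta>)" by (simp add: \<alpha>_def \<beta>_def algebra_simps)
    then show ?thesis by (simp add: \<theta>2)
  qed
  have "(of_int i * \<beta> + of_int j * (of_int i' - of_int j' * \<theta>)) * \<alpha>
      + (of_int j * (of_int i' + of_int j' * \<theta>)) * \<beta> = 1"
    using bez unfolding pe qe by (simp add: algebra_simps)
  then obtain u v \<delta> where u: "u \<in> eisenstein" "v \<in> eisenstein" "u * v = 1"
    and \<delta>: "\<delta> \<in> eisenstein" "\<alpha> = u * \<delta> ^ 3"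
    using eisenstein_cube_factor[OF E eisenstein_of_int[of r] _ _ nz prod]
    by (metis E(2) \<theta>E eisenstein_add eisenstein_diff eisenstein_mult eisenstein_of_int)
  obtain m n where mn: "\<delta> = of_int m + of_int n * omega" using \<delta>(1) by (rule eisensteinE)
  \<comment> \<open>An element \<open>x + y omega\<close> lies in \<open>\<int>[\<theta>]\<close> if \<open>y\<close> is even. For \<open>\<delta>\<close>, \<open>omega \<delta>\<close> and
    \<open>omega^2 \<delta>\<close> these coordinates are \<open>n\<close>, \<open>m - n\<close> and \<open>- m\<close>, whose sum is \<open>0\<close>.\<close>
  have "\<exists>c e. \<delta> ^ 3 = (of_int c + of_int e * \<theta>) ^ 3"
  proof -
    have even_case: "\<exists>c e. of_int x + of_int y * omega = of_int c + of_int e * \<theta>" if "even y" for x y :: int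
    proof -
      from that obtain k where "y = 2 * k" by blast
      then show ?thesis
        by (intro exI[of _ "x - k"] exI[of _ k]) (simp add: \<theta>_def algebra_simps)
    qed
    have "omega * \<delta> = of_int (- n) + of_int (m - n) * omega + of_int n * (omega * omega + 1 + omega)"
      "omega\<^sup>2 * \<delta> = of_int (n - m) + of_int (- m) * omega
         + (of_int m + of_int n * (omega - 1)) * (omega * omega + 1 + omega)"
      by (simp_all add: mn power2_eq_square algebra_simps)
    then have rot: "omega * \<delta> = of_int (- n) + of_int (m - n) * omega"
      "omega\<^sup>2 * \<delta> = of_int (n - m) + of_int (- m) * omega"
      by (simp_all add: omega_square)
    have "(omega * \<delta>) ^ 3 = \<delta> ^ 3" "(omega\<^sup>2 * \<delta>) ^ 3 = \<delta> ^ 3"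
      using power_commutes[of omega 2] omega_cube
      by (simp_all add: power_mult_distrib power2_eq_square)
    moreover have "even n \<or> even (m - n) \<or> even (- m)" by auto
    ultimately show ?thesis using even_case rot mn by metis
  qed
  then obtain c e where ce: "\<delta> ^ 3 = (of_int c + of_int e * \<theta>) ^ 3" by blast
  define P Q where "P = c * (c - 3 * e) * (c + 3 * e)" and "Q = 3 * e * (c - e) * (c + e)"
  have "(of_int c + of_int e * \<theta>) ^ 3
      = of_int c ^ 3 + 3 * of_int c * of_int e ^ 2 * (\<theta> * \<theta>)
        + (3 * of_int c ^ 2 * of_int e + of_int e ^ 3 * (\<theta> * \<theta>)) * \<theta>"
    by (simp add: power2_eq_square power3_eq_cube algebra_simps)
  also have "\<dots> = of_int P + of_int Q * \<theta>"
    by (simp add: \<theta>2 P_def Q_def power2_eq_square power3_eq_cube algebra_simps)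
  also have "\<dots> = of_int (P + Q) + of_int (2 * Q) * omega"
    by (simp add: \<theta>_def algebra_simps)
  finally have \<delta>3: "\<delta> ^ 3 = of_int (P + Q) + of_int (2 * Q) * omega" by (simp add: ce)
  have "omega * \<delta> ^ 3 = of_int (- (2 * Q)) + of_int (P - Q) * omega + of_int (2 * Q) * (omega * omega + 1 + omega)"
    by (simp add: \<delta>3 algebra_simps)
  then have w1: "omega * \<delta> ^ 3 = of_int (- (2 * Q)) + of_int (P - Q) * omega"
    by (simp add: omega_square)
  have "omega\<^sup>2 * \<delta> ^ 3 = of_int (- (P - Q)) + of_int (- (P + Q)) * omega + of_int (P - Q) * (omega * omega + 1 + omega)"
    using arg_cong[OF w1, of "\<lambda>z. omega * z"] by (simp add: power2_eq_square algebra_simps)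
  then have w2: "omega\<^sup>2 * \<delta> ^ 3 = of_int (- (P - Q)) + of_int (- (P + Q)) * omega"
    by (simp add: omega_square)
  have neg: "- (of_int x + of_int y * omega) = of_int (- x) + of_int (- y) * omega" for x y :: int
    by simp
  note eq_iff = \<delta>(2)[unfolded \<alpha>_omega]
  consider "u = 1" | "u = - 1" | "u = omega" | "u = - omega" | "u = omega\<^sup>2" | "u = - (omega\<^sup>2)"
    using eisenstein_unit_cases[OF u] by blast
  then have "p = P \<and> q = Q \<or> p = - P \<and> q = - Q"
  proof cases
    case 1
    then show ?thesis using eq_iff unfolding \<delta>3 by (simp only: mult_1 eisenstein_eq_iff) auto
  next
    case 2
    then have "p + q = - (P + Q) \<and> 2 * q = - (2 * Q)"
      using eq_iff unfolding \<delta>3 by (simp only: mult_minus_left mult_1 neg eisenstein_eq_iff)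
    then show ?thesis by auto
  next
    case 3
    then have "p + q = - (2 * Q)"
      using eq_iff unfolding 3 w1 by (simp only: eisenstein_eq_iff)
    then show ?thesis using odd by simp
  next
    case 4
    then have "p + q = - (- (2 * Q))"
      using eq_iff by (simp only: mult_minus_left w1 neg eisenstein_eq_iff)
    then show ?thesis using odd by simp
  next
    case 5
    then have "p + q = - (P - Q) \<and> 2 * q = - (P + Q)"
      using eq_iff by (simp only: w2 eisenstein_eq_iff)
    then have "p + q = 2 * (q + Q)" by simp
    then show ?thesis using odd by simp
  next
    case 6
    then have "p + q = - (- (P - Q)) \<and> 2 * q = - (- (P + Q))"
      using eq_iff by (simp only: mult_minus_left w2 neg eisenstein_eq_iff)
    then have "p + q = 2 * (q - Q)" by simp
    then show ?thesis using odd by simp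
  qed
  then show thesis
    using that[of c e] that[of "- c" "- e"] by (auto simp: P_def Q_def algebra_simps)
qed

section \<open>Fermat's last theorem for exponent 3\<close>

text \<open>
  The greatest common divisor of \<open>a\<close> and \<open>c\<close> is the cube root, up to sign:
  \<open>gcd a c ^ 3 = gcd (a^3) (a b) = \<bar>a\<bar>\<close>.
\<close>

lemma coprime_mult_eq_cube_int:
  fixes a b c :: int
  assumes "coprime a b" "a * b = c ^ 3"
  obtains k where "a = k ^ 3"
proof -
  have "gcd a c ^ 3 = gcd (a ^ 3) (a * b)" using assms(2) by simp
  also have "\<dots> = \<bar>a\<bar> * gcd (a\<^sup>2) b"
    unfolding gcd_mult_distrib_int by (simp add: power2_eq_square power3_eq_cube mult.assoc)
  also have "\<dots> = \<bar>a\<bar>" using assms(1) by simp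
  finally have "a = gcd a c ^ 3 \<or> a = (- gcd a c) ^ 3" by (auto simp: abs_if split: if_splits)
  then show thesis using that by blast
qed

lemma cube_eq_imp_abs_eq_int:
  fixes x y :: int
  assumes "x ^ 3 = y ^ 3"
  shows "\<bar>x\<bar> = \<bar>y\<bar>"
proof (rule power_eq_imp_eq_base)
  show "\<bar>x\<bar> ^ 3 = \<bar>y\<bar> ^ 3" unfolding power_abs[symmetric] assms ..
qed auto

lemma coprime_mult3_eq_cube_int:
  fixes a b c k :: int
  assumes "coprime a b" "coprime a c" "coprime b c" "a * b * c = k ^ 3"
  obtains A B C where "a = A ^ 3" "b = B ^ 3" "c = C ^ 3" "\<bar>A * B * C\<bar> = \<bar>k\<bar>"
proof -
  obtain A where "a = A ^ 3"
    using coprime_mult_eq_cube_int[of a "b * c" k] assms by (auto simp: mult.assoc)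
  moreover obtain B where "b = B ^ 3"
    using coprime_mult_eq_cube_int[of b "a * c" k] assms by (auto simp: ac_simps)
  moreover obtain C where "c = C ^ 3"
    using coprime_mult_eq_cube_int[of c "a * b" k] assms by (auto simp: ac_simps)
  moreover have "(A * B * C) ^ 3 = k ^ 3" using calculation assms(4) by (simp add: power_mult_distrib)
  then have "\<bar>A * B * C\<bar> = \<bar>k\<bar>" by (rule cube_eq_imp_abs_eq_int)
  ultimately show thesis using that by blast
qed

text \<open>
  Both cases of the descent end here. The three factors are pairwise coprime, hence cubes, and they
  satisfy the linear relation \<open>2 b + (a - b) - (a + b) = 0\<close>.
\<close>

lemma fermat3_from_cube_product:
  fixes a b k :: int
  assumes cop: "coprime a b" and odd: "odd (a + b)" and prod: "2 * b * (a - b) * (a + b) = k ^ 3"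
  obtains A B C where "A ^ 3 + B ^ 3 + C ^ 3 = 0" "\<bar>A * B * C\<bar> = \<bar>k\<bar>"
proof -
  have odd': "odd (a - b)" using odd by simp
  have "coprime b (a - b)" using cop coprime_diff_one_left
    by (metis coprime_commute coprime_iff_gcd_eq_1 gcd_diff1)
  then have "coprime (2 * b) (a - b)" using odd' by simp
  moreover have "coprime b (a + b)" using cop
    by (metis coprime_commute coprime_iff_gcd_eq_1 gcd_add1)
  then have "coprime (2 * b) (a + b)" using odd by simp
  moreover have "coprime (a - b) (a + b)"
  proof -
    have "coprime (a - b) ((a - b) + 2 * b)"
      using \<open>coprime (2 * b) (a - b)\<close>
      by (metis add.commute coprime_commute coprime_iff_gcd_eq_1 gcd_add1)
    then show ?thesis by (simp add: algebra_simps)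
  qed
  ultimately obtain A B C where "2 * b = A ^ 3" "a - b = B ^ 3" "a + b = C ^ 3" "\<bar>A * B * C\<bar> = \<bar>k\<bar>"
    using coprime_mult3_eq_cube_int prod by metis
  then show thesis using that[of A B "- C"] by (simp add: abs_mult)
qed

text \<open>
  If \<open>3\<close> does not divide \<open>p\<close>, then \<open>2 p\<close> and \<open>p^2 + 3 q^2\<close> are coprime, hence cubes \<open>k^3\<close> and \<open>r^3\<close>, and
  \<open>k^3 = 2 p = 2 a (a - 3 b) (a + 3 b)\<close> up to sign is the product of the three cubes of a new solution.
  If \<open>p = 3 s\<close>, the product regroups as \<open>18 s (q^2 + 3 s^2)\<close>, where the roles of \<open>p\<close> and \<open>q\<close> are
  exchanged; then \<open>18 s = 27 (2 b (a - b) (a + b))\<close>, and dividing by \<open>27\<close> gives the new solution.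
\<close>

lemma fermat3_descent:
  fixes x y z :: int
  assumes eq: "x ^ 3 + y ^ 3 + z ^ 3 = 0" and nz: "x * y * z \<noteq> 0"
    and cop: "coprime x y" and odd: "odd x" "odd y"
  obtains x' y' z' :: int where "x' ^ 3 + y' ^ 3 + z' ^ 3 = 0" "x' * y' * z' \<noteq> 0"
    "\<bar>x' * y' * z'\<bar> < \<bar>x * y * z\<bar>"
proof -
  obtain p where p: "x + y = 2 * p" using odd by (metis dvd_def odd_even_add)
  define q where "q = x - p"
  have xy: "x = p + q" "y = p - q" using p by (simp_all add: q_def)
  have odd_pq: "odd (p + q)" using odd xy by simp
  have cop_pq: "coprime p q"
  proof (rule coprimeI)
    fix c assume "c dvd p" "c dvd q"
    then have "c dvd x" "c dvd y" by (simp_all add: xy)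
    then show "is_unit c" using cop coprime_common_divisor by blast
  qed
  have z: "(- z) ^ 3 = 2 * p * (p\<^sup>2 + 3 * q\<^sup>2)"
    using eq by (simp add: xy power2_eq_square power3_eq_cube algebra_simps)
  have p0: "p \<noteq> 0" using z nz by auto
  note result = that
  have enough: thesis if "A ^ 3 + B ^ 3 + C ^ 3 = 0" "A * B * C \<noteq> 0" "\<bar>A * B * C\<bar> < \<bar>z\<bar>" for A B C :: int
  proof (rule result)
    have "0 < \<bar>x * y\<bar>" using nz by simp
    then have "1 \<le> \<bar>x * y\<bar>" by linarith
    then have "1 * \<bar>z\<bar> \<le> \<bar>x * y\<bar> * \<bar>z\<bar>" by (intro mult_right_mono) auto
    then show "\<bar>A * B * C\<bar> < \<bar>x * y * z\<bar>" using \<open>\<bar>A * B * C\<bar> < \<bar>z\<bar>\<close> by (simp add: abs_mult)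
  qed (use that in auto)
  show thesis
  proof (cases "3 dvd p")
    case False
    have "coprime (2 * p) (p\<^sup>2 + 3 * q\<^sup>2)"
    proof (rule coprime_intI_prime)
      show "p\<^sup>2 + 3 * q\<^sup>2 \<noteq> 0" using z nz by auto
    next
      fix l :: int assume l: "prime l" "l dvd 2 * p" "l dvd p\<^sup>2 + 3 * q\<^sup>2"
      have "l \<noteq> 2" using l(3) odd_pq by auto
      then have lp: "l dvd p" using l primes_dvd_imp_eq[of l 2] by (auto simp: prime_dvd_mult_iff)
      then have "l dvd 3 * q\<^sup>2" using l(3) by (simp add: dvd_add_right_iff power2_eq_square)
      moreover have "\<not> l dvd 3" using l(1) primes_dvd_imp_eq[of l 3] lp False by auto
      ultimately have "l dvd q" using l(1) by (auto simp: prime_dvd_mult_iff dest: prime_dvd_power)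
      then show False using lp cop_pq l(1) by (metis coprime_common_divisor not_prime_unit)
    qed
    then obtain k r where k: "2 * p = k ^ 3" and r: "p\<^sup>2 + 3 * q\<^sup>2 = r ^ 3"
      using z coprime_mult_eq_cube_int by (metis coprime_commute mult.commute)
    obtain a b where a: "p = a * (a - 3 * b) * (a + 3 * b)" and b: "q = 3 * b * (a - b) * (a + b)"
      using square_plus_three_square_cube[OF r cop_pq odd_pq False] by blast
    have "coprime (3 * b) a"
    proof (rule coprime_intI_prime)
      show "a \<noteq> 0" using a p0 by auto
      fix l :: int assume l: "prime l" "l dvd 3 * b" "l dvd a"
      then have "l dvd p" "l dvd q" using a b by auto
      then show False using cop_pq l(1) by (metis coprime_common_divisor not_prime_unit)
    qed
    moreover have "odd (3 * b + a)" using odd_pq a b by auto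
    moreover have "2 * a * (3 * b - a) * (3 * b + a) = (- k) ^ 3"
      using k a by (simp add: power3_eq_cube algebra_simps)
    ultimately obtain A B C where ABC: "A ^ 3 + B ^ 3 + C ^ 3 = 0" "\<bar>A * B * C\<bar> = \<bar>k\<bar>"
      using fermat3_from_cube_product[of "3 * b" a "- k"] by auto
    have k0: "k \<noteq> 0" using k p0 by auto
    \<comment> \<open>The descent is strict because \<open>r > 1\<close>: as \<open>2 p\<close> is an even cube, \<open>4\<close> divides \<open>p\<close>.\<close>
    have "even (k ^ 3)" using k by (metis dvd_triv_left)
    then obtain k' where "k = 2 * k'" by auto
    then have "p = 4 * k' ^ 3" using k by (simp add: power_mult_distrib)
    moreover from this have "k' ^ 3 \<noteq> 0" using p0 by simp
    ultimately have "\<bar>p\<bar> > 1" by linarith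
    then have "1 < \<bar>p\<bar>\<^sup>2" by (metis one_less_power pos2)
    then have "1 < p\<^sup>2" by simp
    then have "1 < r ^ 3" using zero_le_power2[of q] unfolding r[symmetric] by linarith
    then have r1: "1 < r" by (smt (verit) power_le_one zero_le_power_eq_numeral odd_numeral power_less_zero_eq_numeral)
    have "(- z) ^ 3 = (k * r) ^ 3" using z k r by (simp add: power_mult_distrib)
    then have "\<bar>- z\<bar> = \<bar>k * r\<bar>" by (rule cube_eq_imp_abs_eq_int)
    then have "\<bar>k\<bar> < \<bar>z\<bar>" using r1 k0 by (simp add: abs_mult)
    then show thesis using enough[OF ABC(1)] ABC(2) k0 by (metis abs_eq_0)
  next
    case True
    then obtain s where s: "p = 3 * s" by blast
    have q3: "\<not> 3 dvd q"
    proof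
      assume "3 dvd q"
      then have "is_unit (3 :: int)" using True cop_pq coprime_common_divisor by blast
      then show False by simp
    qed
    have "coprime (18 * s) (q\<^sup>2 + 3 * s\<^sup>2)"
    proof (rule coprime_intI_prime)
      show "q\<^sup>2 + 3 * s\<^sup>2 \<noteq> 0" using p0 s by (simp add: add_nonneg_eq_0_iff)
    next
      fix l :: int assume l: "prime l" "l dvd 18 * s" "l dvd q\<^sup>2 + 3 * s\<^sup>2"
      have "l \<noteq> 2" using l(3) odd_pq s by auto
      then have "\<not> l dvd 2" using l(1) primes_dvd_imp_eq[of l 2] by auto
      moreover have "\<not> l dvd 3"
      proof
        assume "l dvd 3"
        then have "l = 3" using l(1) primes_dvd_imp_eq[of l 3] by auto
        then have "3 dvd q\<^sup>2" using l(3) by (simp add: dvd_add_left_iff)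
        then show False using q3 prime_dvd_power[of "3::int" q 2] by simp
      qed
      ultimately have "\<not> l dvd 2 * (3 * 3)" using l(1) by (simp only: prime_dvd_mult_iff) simp
      then have ls: "l dvd s" using l(1,2) by (simp add: prime_dvd_mult_iff)
      then have "l dvd q\<^sup>2" using l(3) by (simp add: dvd_add_left_iff power2_eq_square)
      then have "l dvd q" using l(1) prime_dvd_power by blast
      then show False using ls s cop_pq l(1) by (metis coprime_common_divisor dvd_mult not_prime_unit)
    qed
    moreover have "18 * s * (q\<^sup>2 + 3 * s\<^sup>2) = (- z) ^ 3"
      using z s by (simp add: power2_eq_square algebra_simps)
    ultimately obtain k r where k: "18 * s = k ^ 3" and r: "q\<^sup>2 + 3 * s\<^sup>2 = r ^ 3"
      using coprime_mult_eq_cube_int by (metis coprime_commute mult.commute)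
    have cop_qs: "coprime q s" using cop_pq s by (simp add: coprime_commute)
    have odd_qs: "odd (q + s)" using odd_pq s by auto
    obtain a b where a: "q = a * (a - 3 * b) * (a + 3 * b)" and b: "s = 3 * b * (a - b) * (a + b)"
      using square_plus_three_square_cube[OF r cop_qs odd_qs q3] by blast
    have "coprime a b"
    proof (rule coprimeI)
      fix c assume "c dvd a" "c dvd b"
      then have "c dvd q" "c dvd s" using a b by auto
      then show "is_unit c" using cop_qs coprime_common_divisor by blast
    qed
    moreover have "odd (a + b)" using odd_qs a b by auto
    moreover
    have "3 dvd k ^ 3" using k dvd_mult2[of 3 18 s] by simp
    then have "3 dvd k" using prime_dvd_power[of "3::int" k 3] by simp
    then obtain m where m: "k = 3 * m" by blast
    moreover have "2 * b * (a - b) * (a + b) = m ^ 3"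
      using k b by (simp add: m power_mult_distrib)
    ultimately obtain A B C where ABC: "A ^ 3 + B ^ 3 + C ^ 3 = 0" "\<bar>A * B * C\<bar> = \<bar>m\<bar>"
      using fermat3_from_cube_product[of a b m] by auto
    have m0: "m \<noteq> 0" using k p0 s m by auto
    have "(- z) ^ 3 = (k * r) ^ 3"
      using z s unfolding power_mult_distrib k[symmetric] r[symmetric]
      by (simp add: power2_eq_square algebra_simps)
    then have "\<bar>- z\<bar> = \<bar>k * r\<bar>" by (rule cube_eq_imp_abs_eq_int)
    then have "\<bar>z\<bar> = 3 * \<bar>m\<bar> * \<bar>r\<bar>" "r \<noteq> 0" using nz by (auto simp: abs_mult m)
    moreover from this have "3 * \<bar>m\<bar> * 1 \<le> 3 * \<bar>m\<bar> * \<bar>r\<bar>" by (intro mult_left_mono) auto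
    ultimately have "\<bar>m\<bar> < \<bar>z\<bar>" using m0 by linarith
    then show thesis using enough[OF ABC(1)] ABC(2) m0 by (metis abs_eq_0)
  qed
qed

text \<open>
  A nontrivial solution with the least \<open>\<bar>x y z\<bar>\<close> is pairwise coprime, as a common prime factor of two
  of the numbers divides the third. Then exactly two of the numbers are odd, and the descent applies to them.
\<close>

lemma fermat3_int:
  fixes x y z :: int
  assumes "x ^ 3 + y ^ 3 + z ^ 3 = 0"
  shows "x * y * z = 0"
  using assms
proof (induction "nat \<bar>x * y * z\<bar>" arbitrary: x y z rule: less_induct)
  case less
  show ?case
  proof (rule ccontr)
    assume nz: "x * y * z \<noteq> 0"
    have IH: False if "x' ^ 3 + y' ^ 3 + z' ^ 3 = 0" "x' * y' * z' \<noteq> 0"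
      "\<bar>x' * y' * z'\<bar> < \<bar>x * y * z\<bar>" for x' y' z'
      using less.hyps[of x' y' z'] that nz by simp
    have cop: "coprime a b" if abc: "a ^ 3 + b ^ 3 + c ^ 3 = 0" "\<bar>a * b * c\<bar> = \<bar>x * y * z\<bar>" for a b c
    proof (rule coprime_intI_prime)
      show "b \<noteq> 0" using abc nz by auto
      fix l :: int assume l: "prime l" "l dvd a" "l dvd b"
      then obtain a' b' where ab: "a = l * a'" "b = l * b'" by blast
      have l0: "l \<noteq> 0" "l > 1" using l(1) by (auto simp: prime_gt_1_int)
      have c3: "c ^ 3 = - (l ^ 3 * (a' ^ 3 + b' ^ 3))" using abc by (simp add: ab power_mult_distrib algebra_simps)
      then have "l dvd c ^ 3" by (simp add: power3_eq_cube)
      then have "l dvd c" using l(1) prime_dvd_power by blast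
      then obtain c' where c: "c = l * c'" by blast
      have "l ^ 3 * (a' ^ 3 + b' ^ 3 + c' ^ 3) = 0" using c3 by (simp add: c power_mult_distrib algebra_simps)
      then have "a' ^ 3 + b' ^ 3 + c' ^ 3 = 0" using l0 by simp
      moreover have prod: "\<bar>x * y * z\<bar> = l ^ 3 * \<bar>a' * b' * c'\<bar>"
        using l0 unfolding abc(2)[symmetric] ab c by (simp add: abs_mult power3_eq_cube)
      moreover have "a' * b' * c' \<noteq> 0" using prod nz by auto
      moreover have "1 < l ^ 3" using l0 by simp
      ultimately show False using IH[of a' b' c'] by simp
    qed
    have odd_case: False if "a ^ 3 + b ^ 3 + c ^ 3 = 0" "\<bar>a * b * c\<bar> = \<bar>x * y * z\<bar>" "odd a" "odd b" for a b c
      using fermat3_descent[OF that(1) _ cop[OF that(1,2)] that(3,4)] that(2) nz IH by (metis abs_eq_0)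
    have "even (x ^ 3 + y ^ 3 + z ^ 3)" using less.prems by simp
    then have par: "even (x + y + z)" by simp
    have "\<not> (even x \<and> even y)" using cop[of x y z] less.prems by auto
    then consider "odd x" "odd y" | "odd y" "odd z" | "odd x" "odd z" using par by auto
    then show False
      using odd_case[of x y z] odd_case[of y z x] odd_case[of x z y] less.prems
      by cases (auto simp: ac_simps)
  qed
qed

lemma fermat3_Rats:
  fixes x y :: real
  assumes rat: "x \<in> \<rat>" "y \<in> \<rat>" and eq: "x ^ 3 + y ^ 3 = 1"
  shows "x = 0 \<or> y = 0"
proof -
  obtain a b where x: "x = of_int a / of_int b" and b: "b \<noteq> 0"
    using rat(1) by (elim Rats_cases') (metis less_irrefl)
  obtain c e where y: "y = of_int c / of_int e" and e: "e \<noteq> 0"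
    using rat(2) by (elim Rats_cases') (metis less_irrefl)
  have a: "of_int a = x * of_int b" and c: "of_int c = y * of_int e"
    using b e by (simp_all add: x y)
  have "(of_int a * of_int e :: real) ^ 3 + (of_int c * of_int b) ^ 3 = (x ^ 3 + y ^ 3) * (of_int (b * e)) ^ 3"
    unfolding a c of_int_mult by (simp add: power_mult_distrib algebra_simps)
  then have "of_int ((a * e) ^ 3 + (c * b) ^ 3 + (- (b * e)) ^ 3) = (0::real)"
    by (simp add: eq)
  then have "(a * e) ^ 3 + (c * b) ^ 3 + (- (b * e)) ^ 3 = 0"
    by (simp only: of_int_eq_0_iff)
  then have "(a * e) * (c * b) * (- (b * e)) = 0" by (rule fermat3_int)
  then show ?thesis using b e by (auto simp: x y)
qed

text \<open>
  The solutions of \<open>X^3 + Y^3 = 1\<close> with \<open>X = 0\<close> or \<open>Y = 0\<close> correspond to \<open>y = -36\<close> and \<open>y = 36\<close>.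
\<close>

lemma mordell_432_Rats:
  fixes x y :: real
  assumes rat: "x \<in> \<rat>" "y \<in> \<rat>" and eq: "y\<^sup>2 + 432 = x ^ 3"
  shows "x = 12"
proof -
  have x0: "x \<noteq> 0" using eq by (auto simp: add_nonneg_eq_0_iff)
  have "((36 + y) / (6 * x)) ^ 3 + ((36 - y) / (6 * x)) ^ 3 = (y\<^sup>2 + 432) / x ^ 3"
    (is "?l = _")
  proof -
    have "(36 + y) ^ 3 + (36 - y) ^ 3 = 216 * (y\<^sup>2 + 432)"
      by (simp add: power2_eq_square power3_eq_cube algebra_simps)
    moreover have "(6 * x) ^ 3 = 216 * x ^ 3" by (simp add: power_mult_distrib)
    ultimately have "?l = (216 * (y\<^sup>2 + 432)) / (216 * x ^ 3)"
      by (simp only: power_divide flip: add_divide_distrib)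
    then show ?thesis by (simp only: mult_divide_mult_cancel_left_if) simp
  qed
  also have "\<dots> = 1" using eq x0 by simp
  finally have "(36 + y) / (6 * x) = 0 \<or> (36 - y) / (6 * x) = 0"
    by (intro fermat3_Rats) (use rat in auto)
  then have "y = - 36 \<or> y = 36" using x0 by auto
  then have "x ^ 3 = 12 ^ 3" using eq by auto
  moreover have "0 \<le> x" using \<open>x ^ 3 = 12 ^ 3\<close> by (metis zero_le_odd_power odd_numeral zero_le_numeral zero_le_power)
  ultimately show ?thesis by (intro power_eq_imp_eq_base[of x 3 12]) auto
qed

section \<open>Arithmetic maps on the sets \<open>D n\<close>\<close>

text \<open>
  Both fields differ only in their carrier \<open>S\<close>, so arithmetic maps can be treated with the ordinary
  operations on the reals.
\<close>

definition real_arithmetic_map :: "real set \<Rightarrow> real set \<Rightarrow> (real \<Rightarrow> real) \<Rightarrow> bool" where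
  "real_arithmetic_map S A f \<longleftrightarrow>
     (\<forall>a\<in>A. f a \<in> S) \<and> (1 \<in> A \<longrightarrow> f 1 = 1) \<and>
     (\<forall>a\<in>A. \<forall>b\<in>A. a + b \<in> A \<longrightarrow> f (a + b) = f a + f b) \<and>
     (\<forall>a\<in>A. \<forall>b\<in>A. a * b \<in> A \<longrightarrow> f (a * b) = f a * f b)"

lemma arithmetic_map_subfield:
  "arithmetic_map (real_field\<lparr>carrier := S\<rparr>) A f \<longleftrightarrow> real_arithmetic_map S A f"
  by (auto simp: arithmetic_map_def real_arithmetic_map_def ring_of_type_algebra_def Pi_iff)

declare D.simps(2) [simp del]

lemma finite_D: "finite (D n)"
  by (induction n) (auto simp: D.simps(2))

lemma D_mono_0: "D 0 \<subseteq> D n"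
  by (induction n) (auto simp: D.simps(2))

lemma d_0: "d 0 = 1728"
  by (simp add: d_def)

lemma D_Suc: "D (Suc n) = insert ((d n)\<^sup>2) (D n)"
  by (simp add: d_def D.simps(2))

lemma d_mem: "d n \<in> D n"
  unfolding d_def using finite_D D_mono_0[of n] by (intro Max_in) auto

lemma le_d: "x \<in> D n \<Longrightarrow> x \<le> d n"
  unfolding d_def using finite_D by simp

lemma d_ge: "1728 \<le> d n"
  using le_d[of 1728 n] D_mono_0[of n] by auto

lemma d_Suc: "d (Suc n) = (d n)\<^sup>2"
proof -
  have "d n \<le> (d n)\<^sup>2" using d_ge[of n] by (intro self_le_power) auto
  then show ?thesis
    unfolding d_def[of "Suc n"] D_Suc using finite_D le_d
    by (intro Max_eqI) (auto intro: order_trans)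
qed

text \<open>
  These are the factors that have to be distinguished when a multiple of \<open>(d n)^2\<close> is to be located
  relative to \<^term>\<open>D n\<close>.
\<close>

lemma D_cases: "x \<in> D n \<Longrightarrow> x = - 36 \<or> x = 1/2 \<or> x = 1 \<or> 2 \<le> x"
proof (induction n)
  case (Suc n)
  have "2 ^ 2 \<le> (d n)\<^sup>2" using d_ge[of n] by (intro power_mono) auto
  then show ?case using Suc unfolding D_Suc by auto
qed auto

lemma D_subset_Rats: "D n \<subseteq> \<rat>"
proof (induction n)
  case (Suc n)
  then show ?case using d_mem[of n] unfolding D_Suc by auto
qed auto

section \<open>Rigidity over the rationals\<close>

lemma rat_map_fixes_1728:
  assumes f: "real_arithmetic_map \<rat> A f" and A: "D 0 \<subseteq> A"
  shows "f 1728 = 1728"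
proof -
  have add: "f (a + b) = f a + f b" if "a \<in> D 0" "b \<in> D 0" "a + b \<in> D 0" for a b
    using that f A unfolding real_arithmetic_map_def by blast
  have mult: "f (a * b) = f a * f b" if "a \<in> D 0" "b \<in> D 0" "a * b \<in> D 0" for a b
    using that f A unfolding real_arithmetic_map_def by blast
  have one: "f 1 = 1" using f A unfolding real_arithmetic_map_def by auto
  have half: "f (1/2) = 1/2" using add[of "1/2" "1/2"] one by simp
  have two: "f 2 = 2" using add[of 1 1] one by simp
  have "f (5/2) = 5/2" using add[of "1/2" 2] half two by simp
  then have five: "f 5 = 5" using add[of "5/2" "5/2"] by simp
  then have tf: "f 25 = 25" using mult[of 5 5] by simp
  then have "f 50 = 50" using add[of 25 25] by simp
  then have "f 100 = 100" using add[of 50 50] by simp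
  then have "f 200 = 200" using add[of 100 100] by simp
  then have "f 400 = 400" using add[of 200 200] by simp
  then have "f 425 = 425" using add[of 25 400] tf by simp
  then have "f 430 = 430" using add[of 5 425] five by simp
  then have "f 432 = 432" using add[of 2 430] two by simp
  then have "f 1728 = (f (-36))\<^sup>2 + 432"
    using mult[of "-36" "-36"] add[of 1296 432] by (simp add: power2_eq_square)
  moreover have cube: "f 1728 = f 12 ^ 3"
    using mult[of 12 12] mult[of 12 144] by (simp add: power3_eq_cube)
  ultimately have "(f (-36))\<^sup>2 + 432 = f 12 ^ 3" by simp
  moreover have "f 12 \<in> \<rat>" "f (-36) \<in> \<rat>"
    using f A unfolding real_arithmetic_map_def by auto
  ultimately have "f 12 = 12" using mordell_432_Rats by blast
  then show ?thesis using cube by simp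
qed

lemma rat_map_fixes_d:
  assumes f: "real_arithmetic_map \<rat> A f" and A: "D n \<subseteq> A"
  shows "f (d n) = d n"
  using A
proof (induction n)
  case 0
  then show ?case using rat_map_fixes_1728[OF f] by (simp only: d_0)
next
  case (Suc n)
  then have "d n \<in> A" "d n * d n \<in> A" using d_mem[of n] by (auto simp: D_Suc power2_eq_square)
  then have "f (d n * d n) = f (d n) * f (d n)" using f unfolding real_arithmetic_map_def by blast
  then show ?case using Suc by (auto simp: D_Suc d_Suc power2_eq_square)
qed

lemma rat_neighbourhood: "arithmetic_neighbourhood rat_field (D n) (d n)"
  unfolding arithmetic_neighbourhood_def rat_field_def arithmetic_map_subfield
  using finite_D d_mem D_subset_Rats rat_map_fixes_d by simp

section \<open>A nontrivial map over \<open>\<rat>(\<surd>5)\<close>\<close>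

text \<open>
  The point \<open>(8, 4 \<surd>5)\<close> takes the place of \<open>(12, -36)\<close> on the curve \<open>y^2 + 432 = x^3\<close>; the other
  values are forced by \<open>144 = 12^2\<close>, \<open>1296 = (-36)^2\<close> and \<open>1728 = 12 * 144\<close>.
\<close>

definition twist :: "real \<Rightarrow> real" where
  "twist x = (if x = - 36 then 4 * sqrt 5 else if x = 12 then 8 else if x = 144 then 64
     else if x = 1296 then 80 else if x = 1728 then 512 else x)"

lemma twist_arithmetic:
  assumes "sqrt 5 \<in> S" "\<rat> \<subseteq> S" "\<And>a b. a \<in> S \<Longrightarrow> b \<in> S \<Longrightarrow> a * b \<in> S"
  shows "real_arithmetic_map S (D 0) twist"
proof -
  have "twist x \<in> S" if "x \<in> D 0" for x
  proof -
    have "4 \<in> S" using assms(2) by auto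
    then have "4 * sqrt 5 \<in> S" using assms by blast
    moreover have "x \<in> S" using that D_subset_Rats assms(2) by blast
    ultimately show ?thesis unfolding twist_def using assms(2) by auto
  qed
  moreover have "twist 1 = 1" by (simp add: twist_def)
  moreover have "\<forall>a\<in>D 0. \<forall>b\<in>D 0. a + b \<in> D 0 \<longrightarrow> twist (a + b) = twist a + twist b"
    unfolding D.simps(1) ball_simps
    by (intro conjI TrueI; simp; simp add: twist_def)
  moreover have "\<forall>a\<in>D 0. \<forall>b\<in>D 0. a * b \<in> D 0 \<longrightarrow> twist (a * b) = twist a * twist b"
    unfolding D.simps(1) ball_simps
    by (intro conjI TrueI; simp; simp add: twist_def)
  ultimately show ?thesis unfolding real_arithmetic_map_def by blast
qed

text \<open>
  The new element \<open>M^2\<close> lies so far above the elements of \<open>A\<close> that it takes part in no sum, and in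
  no products except \<open>M * M = M^2\<close> and \<open>M^2 * 1 = M^2\<close>. For instance \<open>M^2 - 36\<close> and \<open>M^2 / 2\<close> still
  exceed \<open>M\<close>, and \<open>(-36) * (-36)\<close> is less than \<open>1728\<close>.
\<close>

lemma extend_by_square:
  fixes M :: real
  assumes f: "real_arithmetic_map S A f" and S: "\<And>a b. a \<in> S \<Longrightarrow> b \<in> S \<Longrightarrow> a * b \<in> S"
    and M: "M \<in> A" "1728 \<le> M" and le: "\<And>x. x \<in> A \<Longrightarrow> x \<le> M"
    and A: "\<And>x. x \<in> A \<Longrightarrow> x = - 36 \<or> x = 1/2 \<or> x = 1 \<or> 2 \<le> x" and one: "1 \<in> A"
  shows "real_arithmetic_map S (insert (M\<^sup>2) A) (f(M\<^sup>2 := f M * f M))"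
proof -
  have big: "1728 * M \<le> M\<^sup>2" using M(2) by (simp add: power2_eq_square)
  have notin: "x \<notin> A" if "M < x" for x using le that by force
  have ne: "x \<noteq> M\<^sup>2" if "x \<in> A" for x using le[OF that] big M(2) by auto
  have ge: "- 36 \<le> x" "x \<noteq> 0" if "x \<in> A" for x using A[OF that] by auto
  define g where "g = f(M\<^sup>2 := f M * f M)"
  have gf: "g x = f x" if "x \<in> A" for x using ne[OF that] by (simp add: g_def)
  have gM: "g (M\<^sup>2) = f M * f M" by (simp add: g_def)
  have add_A: "a + b \<noteq> M\<^sup>2" if "a \<in> A" "b \<in> A" for a b
    using le[OF that(1)] le[OF that(2)] big M(2) by linarith
  have add_M: "M\<^sup>2 + b \<notin> insert (M\<^sup>2) A" if "b \<in> insert (M\<^sup>2) A" for b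
  proof -
    have "- 36 \<le> b" "b \<noteq> 0" using that ge big M(2) by auto
    then show ?thesis using notin[of "M\<^sup>2 + b"] big M(2) by auto
  qed
  have mult_M: "b = 1" if bM: "b \<in> insert (M\<^sup>2) A" "M\<^sup>2 * b \<in> insert (M\<^sup>2) A" for b
  proof -
    consider "b = - 36" | "b = 1/2" | "b = 1" | "2 \<le> b"
    proof -
      have "b = M\<^sup>2 \<or> b = - 36 \<or> b = 1/2 \<or> b = 1 \<or> 2 \<le> b" using bM A by blast
      then show thesis using that big M(2) by auto
    qed
    then show ?thesis
    proof cases
      case 1
      then have "M\<^sup>2 * b < - 36" "M\<^sup>2 * b < 0" using big M(2) by auto
      then show ?thesis using bM(2) ge[of "M\<^sup>2 * b"] big M(2) by auto
    next
      case 2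
      then have "M\<^sup>2 * b = M\<^sup>2 / 2" by simp
      then have "M < M\<^sup>2 * b" "M\<^sup>2 * b \<noteq> M\<^sup>2" using big M(2) by linarith+
      then show ?thesis using bM(2) notin by auto
    next
      case 4
      have "M\<^sup>2 * 2 \<le> M\<^sup>2 * b" using 4 by (intro mult_left_mono) auto
      then have "M < M\<^sup>2 * b" "M\<^sup>2 * b \<noteq> M\<^sup>2" using big M(2) by linarith+
      then show ?thesis using bM(2) notin by auto
    qed
  qed
  have mult_A: "a = M \<and> b = M" if "a \<in> A" "b \<in> A" "a * b = M\<^sup>2" for a b
  proof -
    have pos: "0 < a * b" using that(3) M(2) by simp
    show ?thesis
    proof (cases "0 < a")
      case True
      then have "0 < b" using pos zero_less_mult_pos by blast
      have "a * b \<le> M * b" "a * b \<le> a * M"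
        using le[OF that(1)] le[OF that(2)] True \<open>0 < b\<close> by (auto intro: mult_left_mono mult_right_mono)
      then have "M \<le> b" "M \<le> a" using that(3) M(2) by (auto simp: power2_eq_square)
      then show ?thesis using le that by force
    next
      case False
      then have "a < 0" "b < 0" using pos by (auto simp: zero_less_mult_iff)
      then have "a = - 36" "b = - 36" using A[OF that(1)] A[OF that(2)] by auto
      then show ?thesis using that(3) big M(2) by auto
    qed
  qed
  have g1: "g 1 = 1" using gf[OF one] f one by (simp add: real_arithmetic_map_def)
  have fS: "f a \<in> S" if "a \<in> A" for a using f that by (simp add: real_arithmetic_map_def)
  show ?thesis
    unfolding real_arithmetic_map_def g_def[symmetric]
  proof (intro conjI ballI impI)
    fix a assume "a \<in> insert (M\<^sup>2) A"
    then show "g a \<in> S" using gf gM fS S M(1) by auto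
  next
    show "g 1 = 1" by (rule g1)
  next
    fix a b assume ab: "a \<in> insert (M\<^sup>2) A" "b \<in> insert (M\<^sup>2) A" "a + b \<in> insert (M\<^sup>2) A"
    have "a \<in> A" "b \<in> A" using ab add_M[of a] add_M[of b] by (auto simp: add.commute)
    moreover from this have "a + b \<in> A" using ab add_A by auto
    ultimately show "g (a + b) = g a + g b" using f by (simp add: gf real_arithmetic_map_def)
  next
    fix a b assume ab: "a \<in> insert (M\<^sup>2) A" "b \<in> insert (M\<^sup>2) A" "a * b \<in> insert (M\<^sup>2) A"
    consider "a = M\<^sup>2" | "b = M\<^sup>2" | "a \<in> A" "b \<in> A" using ab by auto
    then show "g (a * b) = g a * g b"
    proof cases
      case 1
      then have "b = 1" using mult_M[OF ab(2)] ab(3) by blast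
      then show ?thesis by (simp add: g1)
    next
      case 2
      then have "a = 1" using mult_M[OF ab(1)] ab(3) by (metis mult.commute)
      then show ?thesis by (simp add: g1)
    next
      case 3
      show ?thesis
      proof (cases "a * b \<in> A")
        case True
        then show ?thesis using 3 f by (simp add: gf real_arithmetic_map_def)
      next
        case False
        then have "a * b = M\<^sup>2" using ab by simp
        moreover from this have "a = M" "b = M" using mult_A[OF 3] by blast+
        ultimately show ?thesis by (simp only: gM gf[OF M(1)])
      qed
    qed
  qed
qed

text \<open>
  The images of the greatest elements are \<open>512\<close> and its iterated squares. For the induction it is
  enough to keep the inequalities \<open>0 \<le> f (d n) < d n\<close>, which squaring preserves.
\<close>

lemma sqrt5_map_moves_d:
  assumes S: "sqrt 5 \<in> S" "\<rat> \<subseteq> S" "\<And>a b. a \<in> S \<Longrightarrow> b \<in> S \<Longrightarrow> a * b \<in> S"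
  shows "\<exists>f. real_arithmetic_map S (D n) f \<and> 0 \<le> f (d n) \<and> f (d n) < d n"
proof (induction n)
  case 0
  have "twist 1728 = 512" by (simp add: twist_def)
  then show ?case using twist_arithmetic[OF S] d_0 by (intro exI[of _ twist]) simp
next
  case (Suc n)
  then obtain f where f: "real_arithmetic_map S (D n) f" "0 \<le> f (d n)" "f (d n) < d n" by blast
  have one: "1 \<in> D n" using D_mono_0[of n] by auto
  define g where "g = f((d n)\<^sup>2 := f (d n) * f (d n))"
  have "real_arithmetic_map S (D (Suc n)) g"
    unfolding D_Suc g_def using le_d D_cases d_mem d_ge one
    by (intro extend_by_square[OF f(1) S(3)]) auto
  moreover have "f (d n) * f (d n) < d n * d n"
    using f(2,3) by (intro mult_strict_mono') auto
  moreover have "g (d (Suc n)) = f (d n) * f (d n)"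
    by (simp add: g_def d_Suc)
  ultimately show ?case using f(2)
    by (intro exI[of _ g]) (simp add: d_Suc power2_eq_square)
qed

lemma not_sqrt5_neighbourhood: "\<not> arithmetic_neighbourhood rat_sqrt5_field (D n) (d n)"
proof -
  define S where "S = carrier rat_sqrt5_field"
  have K: "rat_sqrt5_field = real_field\<lparr>carrier := S\<rparr>"
    by (simp add: S_def rat_sqrt5_field_def)
  have rat: "x \<in> S" if "x \<in> \<rat>" for x
    using that unfolding S_def carrier_rat_sqrt5_field
    by (intro CollectI exI[of _ x] exI[of _ 0]) simp
  have root: "sqrt 5 \<in> S"
    unfolding S_def carrier_rat_sqrt5_field
    by (intro CollectI exI[of _ 0] exI[of _ 1]) simp
  interpret field rat_sqrt5_field by (rule field_rat_sqrt5_field)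
  have "a * b \<in> S" if "a \<in> S" "b \<in> S" for a b
    using m_closed[of a b] that by (simp add: S_def rat_sqrt5_field_def ring_of_type_algebra_def)
  then obtain f where "real_arithmetic_map S (D n) f" "f (d n) < d n"
    using sqrt5_map_moves_d[of S n] root rat by blast
  then show ?thesis
    unfolding arithmetic_neighbourhood_def K arithmetic_map_subfield by force
qed

theorem mainTheorem3:
  fixes n :: nat
  shows "arithmetic_neighbourhood rat_field (D n) (d n) \<and>
         \<not> arithmetic_neighbourhood rat_sqrt5_field (D n) (d n)"
  using rat_neighbourhood not_sqrt5_neighbourhood by simp

end
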